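(* Let $X$ be a complex Banach space, $\alpha>0$, $\phi\in\omega_\alpha$, and let $\theta:\tau^\alpha(\phi)\to\mathcal{B}(X)$ be an algebra homomorphism. Then there exists $T\in\mathcal{B}(X)$ such that $$\theta(f)x=\sum_{n=0}^\infty W^\alpha f(n)\,\Delta^{-\alpha}\mathcal{T}(n)x,\qquad f\in\tau^\alpha(\phi),\ x\in X;$$ in particular $\theta(h_n^\alpha)=\Delta^{-\alpha}\mathcal{T}(n)$ for $n\in\mathbb{N}_0$, and $\theta(p_\lambda)=(\lambda-T)^{-1}$ for $|\lambda|>\|T\|$.
   Context: $\mathbb{N}_0=\{0,1,2,\dots\}$. $\mathcal{B}(X)$ is the algebra of bounded linear operators on $X$ and $I$ is the identity. $c_{0,0}$ is the space of complex sequences on $\mathbb{N}_0$ with finite support; convolution is $(f*g)(n)=\sum_{j=0}^nf(n-j)g(j)$. $\ell^1_\phi$ is the space of complex sequences with $\sum_n\phi(n)|f(n)|<\infty$. For $\alpha>0$, $k^\alpha(n)=\frac{\Gamma(n+\alpha)}{\Gamma(\alpha)\Gamma(n+1)}$. For $T\in\mathcal{B}(X)$, $\Delta^{-\alpha}\mathcal{T}(n)=\sum_{j=0}^nk^\alpha(n-j)T^j$ (with $T^0=I$). $h_n^\alpha(j)=k^\alpha(n-j)$ for $0\le j\le n$ and $h_n^\alpha(j)=0$ for $j>n$. For $\lambda\in\mathbb{C}\setminus\{0\}$, $p_\lambda(n)=\lambda^{-(n+1)}$. Weyl sums and differences: for $f\in c_{0,0}$ and $\alpha>0$, $W^{-\alpha}f(n)=\sum_{j=n}^\infty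 k^\alpha(j-n)f(j)$ and $W^\alpha f=(-1)^m\Delta^mW^{-(m-\alpha)}f$ with $m=[\alpha]+1$, where $\Delta f(n)=f(n+1)-f(n)$. A positive sequence $\phi$ belongs to $\omega_{\alpha,loc}$ if there is $c_\phi>0$ with $$\Big(\sum_{n=0}^j+\sum_{n=p+1}^{j+p}\Big)k^\alpha(n)\phi(j+p-n)\le c_\phi\,\phi(j)\phi(p),\qquad 1\le j\le p.$$ $\omega_\alpha$ is the set of nondecreasing $\phi\in\omega_{\alpha,loc}$ which are of exponential type (i.e. $\phi(n)\le Ca^n$ for some $C,a>0$) and satisfy $\inf_{n\ge0}(k^{\alpha+1}(n))^{-1}\phi(n)>0$. For $\phi\in\omega_{\alpha}$, $q_\phi(f)=\sum_{n=0}^\infty\phi(n)|W^\alpha f(n)|$ is a norm on $c_{0,0}$ for which convolution is continuous, and $\tau^\alpha(\phi)$ is the convolution Banach algebra obtained as the completion of $c_{0,0}$ in $q_\phi$. The map $W^\alpha$ extends to $\tau^\alpha(\phi)$ with values in $\ell^1_\phi$, and elements $f\in\tau^\alpha(\phi)$ are regarded as sequences via $f(m)=\sum_{n=m}^\infty k^\alpha(n-m)W^\alpha f(n)$.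
   Formalization: The homomorphism θ is assumed unital and bounded (the formula forces both; θ=0 is a counterexample otherwise), and θ(p_λ)=(λ−T)^{-1} for |λ|>‖T‖ is claimed only when p_λ lies in τ^α(φ), which is shown for |λ|>a whenever φ(n)≤Ca^n. *)

theory Defs
  imports "HOL-Analysis.Analysis"
begin

section \<open>Complex Banach spaces and their bounded operators\<close>

text \<open>The library only provides real Banach spaces; a complex one is a real one with a
  compatible complex scalar multiplication.\<close>

class complex_banach = banach +
  fixes scaleC :: "complex \<Rightarrow> 'a \<Rightarrow> 'a" (infixr "*\<^sub>C" 75)
  assumes scaleC_add_right: "c *\<^sub>C (x + y) = c *\<^sub>C x + c *\<^sub>C y"
    and scaleC_add_left: "(c + d) *\<^sub>C x = c *\<^sub>C x + d *\<^sub>C x"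
    and scaleC_scaleC: "c *\<^sub>C d *\<^sub>C x = (c * d) *\<^sub>C x"
    and scaleC_of_real: "complex_of_real r *\<^sub>C x = r *\<^sub>R x"
    and norm_scaleC: "norm (c *\<^sub>C x) = cmod c * norm x"

instantiation complex :: complex_banach
begin
definition scaleC_complex :: "complex \<Rightarrow> complex \<Rightarrow> complex"
  where "scaleC_complex c x = c * x"
instance
  by standard (simp_all add: scaleC_complex_def algebra_simps scaleR_conv_of_real norm_mult)
end

text \<open>The algebra of bounded complex-linear operators; the norm of the ambient type is the
  operator norm, the product is \<open>o\<^sub>L\<close>, the unit is \<open>id_blinfun\<close>.\<close>

definition bounded_ops :: "('a::complex_banach \<Rightarrow>\<^sub>L 'a) set"
  where "bounded_ops = {T. \<forall>c x. blinfun_apply T (c *\<^sub>C x) = c *\<^sub>C blinfun_apply T x}"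

definition op_power :: "('a::real_normed_vector \<Rightarrow>\<^sub>L 'a) \<Rightarrow> nat \<Rightarrow> ('a \<Rightarrow>\<^sub>L 'a)"
  where "op_power T j = ((\<lambda>S. T o\<^sub>L S) ^^ j) id_blinfun"

text \<open>\<open>R = (c I - T)\<^sup>-\<^sup>1\<close> as a (two-sided) inverse in the algebra of bounded operators.\<close>

definition is_resolvent ::
  "complex \<Rightarrow> ('a::complex_banach \<Rightarrow>\<^sub>L 'a) \<Rightarrow> ('a \<Rightarrow>\<^sub>L 'a) \<Rightarrow> bool"
  where "is_resolvent c T R \<longleftrightarrow> R \<in> bounded_ops \<and>
    (\<forall>x. blinfun_apply R (c *\<^sub>C x - blinfun_apply T x) = x) \<and>
    (\<forall>x. c *\<^sub>C blinfun_apply R x - blinfun_apply T (blinfun_apply R x) = x)"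


section \<open>Cesaro numbers and sums, Weyl sums and differences\<close>

definition cesaro_k :: "real \<Rightarrow> nat \<Rightarrow> real"
  where "cesaro_k \<alpha> n = Gamma (real n + \<alpha>) / (Gamma \<alpha> * Gamma (real n + 1))"

definition cesaro_sum :: "real \<Rightarrow> ('a::real_normed_vector \<Rightarrow>\<^sub>L 'a) \<Rightarrow> nat \<Rightarrow> ('a \<Rightarrow>\<^sub>L 'a)"
  where "cesaro_sum \<alpha> T n = (\<Sum>j=0..n. cesaro_k \<alpha> (n - j) *\<^sub>R op_power T j)"

definition h_seq :: "real \<Rightarrow> nat \<Rightarrow> nat \<Rightarrow> complex"
  where "h_seq \<alpha> n j = (if j \<le> n then of_real (cesaro_k \<alpha> (n - j)) else 0)"

definition p_seq :: "complex \<Rightarrow> nat \<Rightarrow> complex"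
  where "p_seq c n = inverse (c ^ (n + 1))"

definition unit_seq :: "nat \<Rightarrow> complex"
  where "unit_seq n = (if n = 0 then 1 else 0)"

definition convolution :: "(nat \<Rightarrow> complex) \<Rightarrow> (nat \<Rightarrow> complex) \<Rightarrow> nat \<Rightarrow> complex"
  where "convolution f g n = (\<Sum>j=0..n. f (n - j) * g j)"

definition c00 :: "(nat \<Rightarrow> complex) set"
  where "c00 = {f. finite {n. f n \<noteq> 0}}"

text \<open>The series over \<open>j \<ge> n\<close> is written with the shifted index \<open>j - n\<close>.\<close>

definition weyl_sum :: "real \<Rightarrow> (nat \<Rightarrow> complex) \<Rightarrow> nat \<Rightarrow> complex"
  where "weyl_sum \<alpha> f n = (\<Sum>i. of_real (cesaro_k \<alpha> i) * f (n + i))"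

definition fwd_diff :: "(nat \<Rightarrow> complex) \<Rightarrow> nat \<Rightarrow> complex"
  where "fwd_diff f n = f (n + 1) - f n"

definition weyl_diff :: "real \<Rightarrow> (nat \<Rightarrow> complex) \<Rightarrow> nat \<Rightarrow> complex"
  where "weyl_diff \<alpha> f n =
    (let m = nat \<lfloor>\<alpha>\<rfloor> + 1
     in (- 1) ^ m * (fwd_diff ^^ m) (weyl_sum (real m - \<alpha>) f) n)"


section \<open>Weights\<close>

definition omega_loc :: "real \<Rightarrow> (nat \<Rightarrow> real) set"
  where "omega_loc \<alpha> = {\<phi>. (\<forall>n. \<phi> n > 0) \<and>
    (\<exists>c>0. \<forall>j p. 1 \<le> j \<and> j \<le> p \<longrightarrow>
      (\<Sum>n=0..j. cesaro_k \<alpha> n * \<phi> (j + p - n)) +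
      (\<Sum>n=p+1..j+p. cesaro_k \<alpha> n * \<phi> (j + p - n)) \<le> c * \<phi> j * \<phi> p)}"

definition omega :: "real \<Rightarrow> (nat \<Rightarrow> real) set"
  where "omega \<alpha> = {\<phi>. \<phi> \<in> omega_loc \<alpha> \<and> mono \<phi> \<and>
    (\<exists>C>0. \<exists>a>0. \<forall>n. \<phi> n \<le> C * a ^ n) \<and>
    (INF n. inverse (cesaro_k (\<alpha> + 1) n) * \<phi> n) > 0}"


section \<open>The algebra \<open>\<tau>\<^sup>\<alpha>(\<phi>)\<close>\<close>

definition l1_weighted :: "(nat \<Rightarrow> real) \<Rightarrow> (nat \<Rightarrow> complex) set"
  where "l1_weighted \<phi> = {g. summable (\<lambda>n. \<phi> n * cmod (g n))}"

definition l1_norm :: "(nat \<Rightarrow> real) \<Rightarrow> (nat \<Rightarrow> complex) \<Rightarrow> real"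
  where "l1_norm \<phi> g = (\<Sum>n. \<phi> n * cmod (g n))"

text \<open>
  On \<open>c00\<close> the norm is \<open>q\<^sub>\<phi>(f) = l1_norm \<phi> (weyl_diff \<alpha> f)\<close>, so \<open>weyl_diff \<alpha>\<close> embeds
  \<open>(c00, q\<^sub>\<phi>)\<close> isometrically into the Banach space \<open>l1_weighted \<phi>\<close>. The completion is therefore
  the closure of its image: an element is given by a limit \<open>g\<close> in \<open>l1_weighted \<phi>\<close> of
  \<open>weyl_diff \<alpha> (F i)\<close> with \<open>F i \<in> c00\<close>. This \<open>g\<close> is the value of the extended Weyl difference
  at that element, and the element is regarded as the sequence
  \<open>f(m) = \<Sum>\<^sub>n\<^sub>\<ge>\<^sub>m k\<^sup>\<alpha>(n - m) g(n)\<close>. For \<open>\<phi> \<in> omega \<alpha>\<close> the sequence \<open>f\<close> determines \<open>g\<close>.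
\<close>

definition completion_rel ::
  "real \<Rightarrow> (nat \<Rightarrow> real) \<Rightarrow> (nat \<Rightarrow> complex) \<Rightarrow> (nat \<Rightarrow> complex) \<Rightarrow> bool"
  where "completion_rel \<alpha> \<phi> f g \<longleftrightarrow>
    g \<in> l1_weighted \<phi> \<and>
    (\<exists>F. (\<forall>i::nat. F i \<in> c00) \<and>
         (\<lambda>i. l1_norm \<phi> (\<lambda>n. weyl_diff \<alpha> (F i) n - g n)) \<longlonglongrightarrow> 0) \<and>
    (\<forall>m. (\<lambda>i. of_real (cesaro_k \<alpha> i) * g (m + i)) sums f m)"

definition tau :: "real \<Rightarrow> (nat \<Rightarrow> real) \<Rightarrow> (nat \<Rightarrow> complex) set"
  where "tau \<alpha> \<phi> = {f. \<exists>g. completion_rel \<alpha> \<phi> f g}"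

definition weyl_ext :: "real \<Rightarrow> (nat \<Rightarrow> real) \<Rightarrow> (nat \<Rightarrow> complex) \<Rightarrow> (nat \<Rightarrow> complex)"
  where "weyl_ext \<alpha> \<phi> f = (THE g. completion_rel \<alpha> \<phi> f g)"

definition tau_norm :: "real \<Rightarrow> (nat \<Rightarrow> real) \<Rightarrow> (nat \<Rightarrow> complex) \<Rightarrow> real"
  where "tau_norm \<alpha> \<phi> f = l1_norm \<phi> (weyl_ext \<alpha> \<phi> f)"

text \<open>Homomorphisms of unital complex algebras. The unit of \<open>tau \<alpha> \<phi>\<close> is
  \<open>unit_seq = h_seq \<alpha> 0\<close>; only the values of \<open>\<theta>\<close> on \<open>tau \<alpha> \<phi>\<close> matter.\<close>

definition algebra_hom ::
  "real \<Rightarrow> (nat \<Rightarrow> real) \<Rightarrow> ((nat \<Rightarrow> complex) \<Rightarrow> ('a::complex_banach \<Rightarrow>\<^sub>L 'a)) \<Rightarrow> bool"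
  where "algebra_hom \<alpha> \<phi> \<theta> \<longleftrightarrow>
    (\<forall>f\<in>tau \<alpha> \<phi>. \<theta> f \<in> bounded_ops) \<and>
    (\<forall>f\<in>tau \<alpha> \<phi>. \<forall>g\<in>tau \<alpha> \<phi>. \<theta> (\<lambda>n. f n + g n) = \<theta> f + \<theta> g) \<and>
    (\<forall>c. \<forall>f\<in>tau \<alpha> \<phi>. \<forall>x. blinfun_apply (\<theta> (\<lambda>n. c * f n)) x = c *\<^sub>C blinfun_apply (\<theta> f) x) \<and>
    (\<forall>f\<in>tau \<alpha> \<phi>. \<forall>g\<in>tau \<alpha> \<phi>. \<theta> (convolution f g) = \<theta> f o\<^sub>L \<theta> g) \<and>
    \<theta> unit_seq = id_blinfun"

end

theory Submission
  imports Defs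
begin

text \<open>The semigroup law of the Cesaro numbers and Fubini give \<open>W\<^sup>\<alpha> W\<^sup>-\<^sup>\<alpha> g = g\<close> for all
  \<open>g\<close> in the weighted \<open>\<ell>\<^sup>1\<close> space, so the algebra is the range of \<open>W\<^sup>-\<^sup>\<alpha>\<close> on that space. Take for \<open>T\<close> the
  image of the unit mass at \<open>1\<close>. Then \<open>W\<^sup>-\<^sup>\<alpha>\<close> of the unit mass at \<open>n\<close> is \<open>h\<^sub>n\<close>, a combination of
  convolution powers of the unit mass at \<open>1\<close>, which yields \<open>\<theta>(h\<^sub>n)\<close>; truncating \<open>W\<^sup>\<alpha> f\<close> expands \<open>f\<close> in
  the \<open>h\<^sub>n\<close>, and continuity of \<open>\<theta>\<close> gives the series for \<open>\<theta>(f)\<close>. Finally, \<open>p\<^sub>\<lambda>\<close> is the convolution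
  inverse of \<open>\<lambda>\<delta>\<^sub>0 - \<delta>\<^sub>1\<close>.\<close>

section \<open>Cesaro numbers\<close>

lemma cesaro_k_pochhammer:
  assumes "\<alpha> > 0"
  shows "cesaro_k \<alpha> n = pochhammer \<alpha> n / fact n"
proof -
  have "\<alpha> \<notin> \<int>\<^sub>\<le>\<^sub>0"
    using assms nonpos_Ints_nonpos by fastforce
  then have "pochhammer \<alpha> n = Gamma (\<alpha> + real n) / Gamma \<alpha>"
    by (rule pochhammer_Gamma)
  moreover have "Gamma (real n + 1) = fact n"
    using Gamma_fact[of n, where 'a = real] by (simp add: add.commute)
  ultimately show ?thesis
    by (simp add: cesaro_k_def add.commute)
qed

lemma cesaro_k_0: "\<alpha> > 0 \<Longrightarrow> cesaro_k \<alpha> 0 = 1"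
  by (simp add: cesaro_k_pochhammer)

lemma cesaro_k_1: "cesaro_k 1 n = 1"
  by (simp add: cesaro_k_pochhammer flip: pochhammer_fact)

lemma cesaro_k_pos: "\<alpha> > 0 \<Longrightarrow> cesaro_k \<alpha> n > 0"
  by (simp add: cesaro_k_pochhammer pochhammer_pos)

lemma cesaro_k_mono_left:
  assumes "0 < \<alpha>" "\<alpha> \<le> \<beta>"
  shows "cesaro_k \<alpha> n \<le> cesaro_k \<beta> n"
proof -
  have "pochhammer \<alpha> n \<le> pochhammer \<beta> n"
    unfolding pochhammer_prod using assms by (intro prod_mono) auto
  then show ?thesis
    using assms by (simp add: cesaro_k_pochhammer divide_right_mono)
qed

lemma cesaro_k_mono:
  assumes "\<alpha> \<ge> 1" "m \<le> n"
  shows "cesaro_k \<alpha> m \<le> cesaro_k \<alpha> n"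
proof -
  have "cesaro_k \<alpha> n \<le> cesaro_k \<alpha> (Suc n)" for n
  proof -
    have "cesaro_k \<alpha> (Suc n) = cesaro_k \<alpha> n * ((\<alpha> + real n) / (1 + real n))"
      using assms by (simp add: cesaro_k_pochhammer pochhammer_Suc)
    moreover have "cesaro_k \<alpha> n \<ge> 0" "(\<alpha> + real n) / (1 + real n) \<ge> 1"
      using assms cesaro_k_pos[of \<alpha> n] by auto
    ultimately show ?thesis
      using mult_left_mono[of 1 "(\<alpha> + real n) / (1 + real n)" "cesaro_k \<alpha> n"] by simp
  qed
  then show ?thesis
    using \<open>m \<le> n\<close> lift_Suc_mono_le[of "cesaro_k \<alpha>"] by blast
qed

lemma cesaro_k_ge_1: "\<alpha> \<ge> 1 \<Longrightarrow> cesaro_k \<alpha> n \<ge> 1"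
  using cesaro_k_mono[of \<alpha> 0 n] by (simp add: cesaro_k_0)

lemma cesaro_k_convolution:
  assumes "\<alpha> > 0" "\<beta> > 0"
  shows "(\<Sum>j\<le>n. cesaro_k \<beta> j * cesaro_k \<alpha> (n - j)) = cesaro_k (\<alpha> + \<beta>) n"
proof -
  have "cesaro_k (\<alpha> + \<beta>) n
      = (\<Sum>j\<le>n. real (n choose j) * pochhammer \<beta> j * pochhammer \<alpha> (n - j)) / fact n"
    unfolding add.commute[of \<alpha> \<beta>]
    using assms by (simp add: cesaro_k_pochhammer pochhammer_binomial_sum)
  also have "\<dots> = (\<Sum>j\<le>n. cesaro_k \<beta> j * cesaro_k \<alpha> (n - j))"
    unfolding sum_divide_distrib
    using assms by (intro sum.cong) (simp_all add: cesaro_k_pochhammer binomial_fact)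
  finally show ?thesis ..
qed

lemma cesaro_k_Suc_diff:
  assumes "s > 0"
  shows "cesaro_k (s + 1) (Suc n) - cesaro_k (s + 1) n = cesaro_k s (Suc n)"
proof -
  have "cesaro_k (1 + s) (Suc n)
      = (\<Sum>j\<le>Suc n. cesaro_k s j)" "cesaro_k (1 + s) n = (\<Sum>j\<le>n. cesaro_k s j)"
    using assms by (simp_all add: cesaro_k_1 del: sum.atMost_Suc flip: cesaro_k_convolution)
  then show ?thesis
    by (simp add: add.commute)
qed

section \<open>Weyl sums and differences\<close>

lemma weyl_sum_weyl_sum:
  assumes "\<alpha> > 0" "\<beta> > 0"
    and summ: "summable (\<lambda>i. cesaro_k (\<alpha> + \<beta>) i * cmod (g (n + i)))"
  shows "weyl_sum \<beta> (weyl_sum \<alpha> g) n = weyl_sum (\<alpha> + \<beta>) g n"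
proof -
  let ?h = "\<lambda>(l, j). of_real (cesaro_k \<beta> j * cesaro_k \<alpha> (l - j)) * g (n + l)"
  let ?H = "\<lambda>(j, i). of_real (cesaro_k \<beta> j) * (of_real (cesaro_k \<alpha> i) * g (n + j + i))"
  let ?S = "Sigma UNIV (\<lambda>l::nat. {..l})"
  let ?s = "\<lambda>l. of_real (cesaro_k (\<alpha> + \<beta>) l) * g (n + l)"
  have pos: "cesaro_k \<alpha> i \<ge> 0" "cesaro_k \<beta> i \<ge> 0" "cesaro_k (\<alpha> + \<beta>) i \<ge> 0" for i
    using cesaro_k_pos assms(1,2) by (simp_all add: less_imp_le)
  have bij: "bij_betw (\<lambda>(j, i). (j + i, j)) UNIV ?S"
    by (rule bij_betwI[where g = "\<lambda>(l, j). (j, l - j)"]) auto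
  have inner: "(\<Sum>j\<le>l. cmod (?h (l, j))) = cesaro_k (\<alpha> + \<beta>) l * cmod (g (n + l))" for l
    using pos by (simp add: norm_mult abs_mult flip: sum_distrib_right
        cesaro_k_convolution[OF assms(1,2)])
  have norm_s: "summable (\<lambda>l. cmod (?s l))"
    using summ pos by (simp add: norm_mult)
  have "(\<lambda>p. cmod (?h p)) summable_on ?S"
  proof (rule summable_on_SigmaI)
    fix l
    show "((\<lambda>j. cmod (?h (l, j))) has_sum cesaro_k (\<alpha> + \<beta>) l * cmod (g (n + l))) {..l}"
      using inner[of l] has_sum_finite[of "{..l}" "\<lambda>j. cmod (?h (l, j))"] by simp
    show "(\<lambda>l. cesaro_k (\<alpha> + \<beta>) l * cmod (g (n + l))) summable_on UNIV"
      using summ pos by (subst summable_on_UNIV_nonneg_real_iff) auto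
  qed auto
  then have h_summable: "?h summable_on ?S"
    by (rule abs_summable_summable)
  have "((\<lambda>l. \<Sum>j\<le>l. ?h (l, j)) has_sum infsum ?h ?S) UNIV"
    by (rule has_sum_SigmaD[OF has_sum_infsum[OF h_summable]]) (simp add: has_sum_finite)
  moreover have "(\<Sum>j\<le>l. ?h (l, j)) = ?s l" for l
    by (simp only: prod.case flip: sum_distrib_right of_real_sum cesaro_k_convolution[OF assms(1,2)])
  ultimately have "?s sums infsum ?h ?S"
    using has_sum_imp_sums by simp
  then have right: "weyl_sum (\<alpha> + \<beta>) g n = infsum ?h ?S"
    by (simp add: weyl_sum_def sums_iff)
  have "((\<lambda>(j, i). ?h (j + i, j)) has_sum infsum ?h ?S) UNIV"
    using has_sum_reindex_bij_betw[OF bij, of ?h] has_sum_infsum[OF h_summable]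
    by (simp add: case_prod_unfold)
  then have H: "(?H has_sum infsum ?h ?S) UNIV"
    by (simp add: case_prod_unfold mult.assoc add.assoc)
  have H_row: "((\<lambda>i. ?H (j, i)) has_sum of_real (cesaro_k \<beta> j) * weyl_sum \<alpha> g (n + j)) UNIV" for j
  proof -
    have "(\<lambda>i. ?H (j, i)) summable_on UNIV"
      using summable_on_SigmaD1[of "\<lambda>j i. ?H (j, i)" UNIV "\<lambda>_. UNIV" j] has_sum_imp_summable[OF H]
      by simp
    then have "((\<lambda>i. inverse (of_real (cesaro_k \<beta> j)) * ?H (j, i)) summable_on UNIV)"
      by (rule summable_on_cmult_right)
    moreover have "cesaro_k \<beta> j \<noteq> 0"
      using cesaro_k_pos[OF assms(2)] by (metis less_irrefl)
    ultimately have "(\<lambda>i. of_real (cesaro_k \<alpha> i) * g (n + j + i)) summable_on UNIV"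
      by (simp flip: mult.assoc)
    then obtain S where S: "((\<lambda>i. of_real (cesaro_k \<alpha> i) * g (n + j + i)) has_sum S) UNIV"
      by (auto simp: summable_on_def)
    then have "S = weyl_sum \<alpha> g (n + j)"
      using has_sum_imp_sums[OF S] by (simp add: weyl_sum_def sums_iff)
    then show ?thesis
      using has_sum_cmult_right[OF S] by simp
  qed
  have "((\<lambda>j. of_real (cesaro_k \<beta> j) * weyl_sum \<alpha> g (n + j)) has_sum infsum ?h ?S) UNIV"
    using has_sum_SigmaD[of ?H UNIV "\<lambda>_. UNIV"] H H_row by simp
  from has_sum_imp_sums[OF this] show ?thesis
    unfolding right by (simp add: weyl_sum_def sums_iff)
qed

lemma summable_cesaro_mono:
  assumes "0 < \<beta>" "\<beta> \<le> \<alpha>" "summable (\<lambda>i. cesaro_k \<alpha> i * cmod (g (n + i)))"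
  shows "summable (\<lambda>i. cesaro_k \<beta> i * cmod (g (n + i)))"
  using assms(3)
proof (rule summable_comparison_test[rotated])
  show "\<exists>N. \<forall>i\<ge>N. norm (cesaro_k \<beta> i * cmod (g (n + i))) \<le> cesaro_k \<alpha> i * cmod (g (n + i))"
    using assms cesaro_k_pos[of \<beta>] cesaro_k_mono_left[of \<beta> \<alpha>]
    by (auto intro!: mult_right_mono simp: abs_mult less_imp_le)
qed

lemma summable_cesaro_norm:
  assumes "\<alpha> > 0" "summable (\<lambda>i. cesaro_k \<alpha> i * cmod (g (n + i)))"
  shows "summable (\<lambda>i. of_real (cesaro_k \<alpha> i) * g (n + i))"
proof (rule summable_norm_cancel)
  show "summable (\<lambda>i. norm (of_real (cesaro_k \<alpha> i) * g (n + i)))"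
    using assms cesaro_k_pos[of \<alpha>] by (simp add: norm_mult less_imp_le)
qed

lemma fwd_diff_weyl_sum_1:
  assumes "\<And>n. summable (\<lambda>i. cesaro_k 1 i * cmod (g (n + i)))"
  shows "fwd_diff (weyl_sum 1 g) n = - g n"
proof -
  have "summable (\<lambda>i. g (n + i))"
    using summable_cesaro_norm[of 1 g n] assms by (simp add: cesaro_k_1)
  from suminf_split_head[OF this] show ?thesis
    by (simp add: fwd_diff_def weyl_sum_def cesaro_k_1)
qed

lemma fwd_diff_weyl_sum:
  assumes "s > 0" and summ: "\<And>n. summable (\<lambda>i. cesaro_k (s + 1) i * cmod (g (n + i)))"
  shows "fwd_diff (weyl_sum (s + 1) g) n = - weyl_sum s g n"
proof -
  have s1: "summable (\<lambda>i. of_real (cesaro_k (s + 1) i) * g (n + i))" for n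
    using summable_cesaro_norm[of "s + 1"] assms by simp
  have s0: "summable (\<lambda>i. of_real (cesaro_k s i) * g (n + i))"
    using summable_cesaro_norm[of s] summable_cesaro_mono[of s "s + 1"] assms by simp
  have "weyl_sum (s + 1) g n
      = g n + (\<Sum>i. of_real (cesaro_k (s + 1) (Suc i)) * g (Suc n + i))"
    using suminf_split_head[OF s1[of n]] \<open>s > 0\<close> by (simp add: weyl_sum_def cesaro_k_0)
  moreover have "weyl_sum s g n = g n + (\<Sum>i. of_real (cesaro_k s (Suc i)) * g (Suc n + i))"
    using suminf_split_head[OF s0] \<open>s > 0\<close> by (simp add: weyl_sum_def cesaro_k_0)
  moreover have "(\<Sum>i. of_real (cesaro_k (s + 1) (Suc i)) * g (Suc n + i)) - weyl_sum (s + 1) g (Suc n)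
      = (\<Sum>i. of_real (cesaro_k s (Suc i)) * g (Suc n + i))"
    unfolding weyl_sum_def
    using s1[of n] s1[of "Suc n"] summable_Suc_iff[of "\<lambda>i. of_real (cesaro_k (s + 1) i) * g (n + i)"]
    by (subst suminf_diff)
       (auto simp flip: cesaro_k_Suc_diff[OF \<open>s > 0\<close>] simp: left_diff_distrib)
  ultimately show ?thesis
    by (simp add: fwd_diff_def algebra_simps)
qed

lemma fwd_diff_funpow_uminus: "(fwd_diff ^^ m) (\<lambda>n. - f n) = (\<lambda>n. - (fwd_diff ^^ m) f n)"
  by (induction m) (auto simp: fwd_diff_def)

lemma fwd_diff_funpow_weyl_sum:
  assumes "\<And>n. summable (\<lambda>i. cesaro_k (real (Suc m)) i * cmod (g (n + i)))"
  shows "(- 1) ^ Suc m * (fwd_diff ^^ Suc m) (weyl_sum (real (Suc m)) g) n = g n"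
  using assms
proof (induction m)
  case 0
  then show ?case
    using fwd_diff_weyl_sum_1[of g n] by simp
next
  case (Suc m)
  have "summable (\<lambda>i. cesaro_k (real (Suc m)) i * cmod (g (n + i)))" for n
    by (rule summable_cesaro_mono[OF _ _ Suc.prems]) auto
  note IH = Suc.IH[OF this]
  have eq: "real (Suc (Suc m)) = real (Suc m) + 1"
    by simp
  have "fwd_diff (weyl_sum (real (Suc (Suc m))) g) = (\<lambda>n. - weyl_sum (real (Suc m)) g n)"
    unfolding eq by (intro ext fwd_diff_weyl_sum) (use Suc.prems in \<open>simp_all add: eq del: of_nat_Suc\<close>)
  then have "(fwd_diff ^^ Suc (Suc m)) (weyl_sum (real (Suc (Suc m))) g)
      = (\<lambda>n. - (fwd_diff ^^ Suc m) (weyl_sum (real (Suc m)) g) n)"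
    by (simp only: funpow_Suc_right[of "Suc m"] o_apply fwd_diff_funpow_uminus)
  then show ?case
    using IH by simp
qed

lemma weyl_diff_weyl_sum:
  assumes "\<alpha> > 0" and summ: "\<And>n. summable (\<lambda>i. cesaro_k (\<alpha> + 1) i * cmod (g (n + i)))"
  shows "weyl_diff \<alpha> (weyl_sum \<alpha> g) = g"
proof
  fix n
  define p where "p = nat \<lfloor>\<alpha>\<rfloor>"
  have p: "real (Suc p) \<le> \<alpha> + 1" "\<alpha> < real (Suc p)"
    using \<open>\<alpha> > 0\<close> unfolding p_def by linarith+
  have summ': "summable (\<lambda>i. cesaro_k (real (Suc p)) i * cmod (g (n + i)))" for n
    using summable_cesaro_mono[OF _ p(1) summ] by simp
  have "weyl_sum (real (Suc p) - \<alpha>) (weyl_sum \<alpha> g) = weyl_sum (real (Suc p)) g"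
  proof
    fix n
    show "weyl_sum (real (Suc p) - \<alpha>) (weyl_sum \<alpha> g) n = weyl_sum (real (Suc p)) g n"
      using weyl_sum_weyl_sum[of \<alpha> "real (Suc p) - \<alpha>" g n] p(2) \<open>\<alpha> > 0\<close> summ' by simp
  qed
  then show "weyl_diff \<alpha> (weyl_sum \<alpha> g) n = g n"
    using fwd_diff_funpow_weyl_sum[OF summ'] by (simp only: weyl_diff_def Let_def p_def Suc_eq_plus1)
qed

section \<open>The algebra as the range of the Weyl sum\<close>

definition delta_seq :: "nat \<Rightarrow> nat \<Rightarrow> complex"
  where "delta_seq j n = (if n = j then 1 else 0)"

lemma convolution_delta_seq_1: "convolution (delta_seq 1) (delta_seq j) = delta_seq (Suc j)"
proof
  fix n
  have "convolution (delta_seq 1) (delta_seq j) n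
      = (\<Sum>i\<in>{0..n}. if i = j then delta_seq 1 (n - j) else 0)"
    unfolding convolution_def by (intro sum.cong) (auto simp: delta_seq_def)
  also have "\<dots> = delta_seq (Suc j) n"
    by (auto simp: delta_seq_def)
  finally show "convolution (delta_seq 1) (delta_seq j) n = delta_seq (Suc j) n" .
qed

lemma weyl_sum_delta_seq: "weyl_sum \<alpha> (delta_seq n) = h_seq \<alpha> n"
proof
  fix m
  have "weyl_sum \<alpha> (delta_seq n) m
      = (\<Sum>i\<in>(if m \<le> n then {n - m} else {}). of_real (cesaro_k \<alpha> i) * delta_seq n (m + i))"
    unfolding weyl_sum_def by (rule suminf_finite) (auto simp: delta_seq_def split: if_splits)
  then show "weyl_sum \<alpha> (delta_seq n) m = h_seq \<alpha> n m"
    by (simp add: h_seq_def delta_seq_def)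
qed

locale omega_weight =
  fixes \<alpha> :: real and \<phi> :: "nat \<Rightarrow> real"
  assumes alpha_pos: "\<alpha> > 0" and omega: "\<phi> \<in> omega \<alpha>"
begin

lemma phi_pos: "\<phi> n > 0"
  using omega by (simp add: omega_def omega_loc_def)

lemma phi_ge_cesaro_k: "\<exists>d>0. \<forall>n. d * cesaro_k (\<alpha> + 1) n \<le> \<phi> n"
proof (intro exI conjI allI)
  let ?f = "\<lambda>n. inverse (cesaro_k (\<alpha> + 1) n) * \<phi> n"
  have k_pos: "cesaro_k (\<alpha> + 1) n > 0" for n
    using alpha_pos cesaro_k_pos[of "\<alpha> + 1"] by simp
  show "(INF n. ?f n) > 0"
    using omega by (simp add: omega_def)
  have "bdd_below (range ?f)"
    using k_pos phi_pos by (intro bdd_belowI[of _ 0]) (auto simp: less_imp_le)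
  then have "(INF n. ?f n) \<le> ?f n" for n
    by (rule cINF_lower) simp
  then have "(INF n. ?f n) * cesaro_k (\<alpha> + 1) n \<le> ?f n * cesaro_k (\<alpha> + 1) n" for n
    using k_pos[of n] by (intro mult_right_mono) auto
  moreover have "?f n * cesaro_k (\<alpha> + 1) n = \<phi> n" for n
    using k_pos[of n] by simp
  ultimately show "(INF n. ?f n) * cesaro_k (\<alpha> + 1) n \<le> \<phi> n" for n
    by metis
qed

lemma l1_weighted_summable:
  assumes "g \<in> l1_weighted \<phi>"
  shows "summable (\<lambda>i. cesaro_k (\<alpha> + 1) i * cmod (g (n + i)))"
proof -
  obtain d where d: "d > 0" "\<And>n. d * cesaro_k (\<alpha> + 1) n \<le> \<phi> n"
    using phi_ge_cesaro_k by blast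
  have le: "cesaro_k (\<alpha> + 1) i \<le> inverse d * \<phi> (i + n)" for i
  proof -
    have "cesaro_k (\<alpha> + 1) i \<le> cesaro_k (\<alpha> + 1) (i + n)"
      using alpha_pos by (intro cesaro_k_mono) auto
    then show ?thesis
      using order_trans[OF mult_left_mono d(2)[of "i + n"], of "cesaro_k (\<alpha> + 1) i"] d(1)
      by (simp add: inverse_eq_divide pos_le_divide_eq mult.commute)
  qed
  have "summable (\<lambda>i. \<phi> (i + n) * cmod (g (i + n)))"
    using assms summable_iff_shift[of "\<lambda>i. \<phi> i * cmod (g i)" n] by (simp add: l1_weighted_def)
  then have "summable (\<lambda>i. inverse d * (\<phi> (i + n) * cmod (g (i + n))))"
    by (rule summable_mult)
  then show ?thesis
  proof (rule summable_comparison_test[rotated], intro exI allI impI)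
    fix i
    have "cesaro_k (\<alpha> + 1) i > 0"
      using alpha_pos cesaro_k_pos[of "\<alpha> + 1"] by simp
    then show "norm (cesaro_k (\<alpha> + 1) i * cmod (g (n + i)))
        \<le> inverse d * (\<phi> (i + n) * cmod (g (i + n)))"
      using mult_right_mono[OF le[of i], of "cmod (g (i + n))"]
      by (simp add: abs_mult add.commute mult.assoc)
  qed
qed

lemma l1_weighted_weyl_sums:
  assumes "g \<in> l1_weighted \<phi>"
  shows "(\<lambda>i. of_real (cesaro_k \<alpha> i) * g (n + i)) sums weyl_sum \<alpha> g n"
  unfolding weyl_sum_def
  using summable_cesaro_mono[OF _ _ l1_weighted_summable[OF assms], of \<alpha>] alpha_pos
  by (intro summable_sums summable_cesaro_norm) auto

lemma l1_weighted_weyl_diff: "g \<in> l1_weighted \<phi> \<Longrightarrow> weyl_diff \<alpha> (weyl_sum \<alpha> g) = g"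
  using weyl_diff_weyl_sum alpha_pos l1_weighted_summable by blast

lemma l1_weighted_finite: "finite {n. g n \<noteq> 0} \<Longrightarrow> g \<in> l1_weighted \<phi>"
  unfolding l1_weighted_def by (auto intro!: summable_finite)

lemma l1_weighted_lincomb:
  assumes "f \<in> l1_weighted \<phi>" "g \<in> l1_weighted \<phi>"
  shows "(\<lambda>n. f n + c * g n) \<in> l1_weighted \<phi>"
proof -
  have "summable (\<lambda>n. \<phi> n * cmod (f n) + cmod c * (\<phi> n * cmod (g n)))"
    using assms by (intro summable_add summable_mult) (auto simp: l1_weighted_def)
  then have "summable (\<lambda>n. \<phi> n * cmod (f n + c * g n))"
  proof (rule summable_comparison_test[rotated], intro exI allI impI)
    fix n
    have "cmod (f n + c * g n) \<le> cmod (f n) + cmod c * cmod (g n)"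
      by (metis norm_mult norm_triangle_ineq)
    then show "norm (\<phi> n * cmod (f n + c * g n)) \<le> \<phi> n * cmod (f n) + cmod c * (\<phi> n * cmod (g n))"
      using phi_pos[of n] mult_left_mono[of "cmod (f n + c * g n)" "cmod (f n) + cmod c * cmod (g n)" "\<phi> n"]
      by (simp add: abs_mult algebra_simps)
  qed
  then show ?thesis
    by (simp add: l1_weighted_def)
qed

lemma weyl_sum_lincomb:
  assumes "f \<in> l1_weighted \<phi>" "g \<in> l1_weighted \<phi>"
  shows "weyl_sum \<alpha> (\<lambda>n. f n + c * g n) = (\<lambda>n. weyl_sum \<alpha> f n + c * weyl_sum \<alpha> g n)"
proof
  fix n
  have "(\<lambda>i. of_real (cesaro_k \<alpha> i) * (f (n + i) + c * g (n + i)))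
      sums (weyl_sum \<alpha> f n + c * weyl_sum \<alpha> g n)"
    using sums_add[OF l1_weighted_weyl_sums[OF assms(1), of n]
        sums_mult[OF l1_weighted_weyl_sums[OF assms(2), of n], of c]]
    by (simp add: algebra_simps)
  then show "weyl_sum \<alpha> (\<lambda>n. f n + c * g n) n = weyl_sum \<alpha> f n + c * weyl_sum \<alpha> g n"
    by (simp add: weyl_sum_def sums_iff)
qed

lemma l1_norm_tail:
  assumes "g \<in> l1_weighted \<phi>"
  shows "(\<lambda>N. l1_norm \<phi> (\<lambda>n. if n < N then 0 else g n)) \<longlonglongrightarrow> 0"
proof -
  let ?a = "\<lambda>n. \<phi> n * cmod (g n)"
  have summ: "summable ?a"
    using assms by (simp add: l1_weighted_def)
  have "l1_norm \<phi> (\<lambda>n. if n < N then 0 else g n) = suminf ?a - sum ?a {..<N}" for N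
  proof -
    have "(\<lambda>n. ?a n - (if n \<in> {..<N} then ?a n else 0)) sums (suminf ?a - sum ?a {..<N})"
      using summ by (intro sums_diff summable_sums sums_If_finite_set) auto
    moreover have "(\<lambda>n. ?a n - (if n \<in> {..<N} then ?a n else 0))
        = (\<lambda>n. \<phi> n * cmod (if n < N then 0 else g n))"
      by auto
    ultimately show ?thesis
      by (simp add: l1_norm_def sums_iff)
  qed
  moreover have "(\<lambda>N. suminf ?a - sum ?a {..<N}) \<longlonglongrightarrow> suminf ?a - suminf ?a"
    using summ by (intro tendsto_diff tendsto_const summable_LIMSEQ)
  ultimately show ?thesis
    by simp
qed

text \<open>The image of \<open>c00\<close> under \<open>weyl_diff\<close> contains all truncations of \<open>g\<close>, hence is dense; so
  the completion is a copy of all of \<open>l1_weighted \<phi>\<close>.\<close>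

lemma completion_rel_iff:
  "completion_rel \<alpha> \<phi> f g \<longleftrightarrow> g \<in> l1_weighted \<phi> \<and> f = weyl_sum \<alpha> g"
proof
  assume rel: "completion_rel \<alpha> \<phi> f g"
  then have g: "g \<in> l1_weighted \<phi>"
    by (simp add: completion_rel_def)
  moreover have "f m = weyl_sum \<alpha> g m" for m
    using l1_weighted_weyl_sums[OF g] rel unfolding completion_rel_def by (blast intro: sums_unique2)
  ultimately show "g \<in> l1_weighted \<phi> \<and> f = weyl_sum \<alpha> g"
    by blast
next
  assume "g \<in> l1_weighted \<phi> \<and> f = weyl_sum \<alpha> g"
  then have g: "g \<in> l1_weighted \<phi>" and f: "f = weyl_sum \<alpha> g"
    by auto
  define t where "t N n = (if n < N then g n else 0)" for N n
  have fin: "finite {n. t N n \<noteq> 0}" for N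
    by (rule finite_subset[of _ "{..<N}"]) (auto simp: t_def)
  have "weyl_sum \<alpha> (t N) \<in> c00" for N
  proof -
    have "weyl_sum \<alpha> (t N) n = 0" if "n \<ge> N" for n
      using that by (simp add: weyl_sum_def t_def)
    then have "{n. weyl_sum \<alpha> (t N) n \<noteq> 0} \<subseteq> {..<N}"
      using not_less by blast
    then show ?thesis
      by (auto simp: c00_def intro: finite_subset)
  qed
  moreover have "l1_norm \<phi> (\<lambda>n. weyl_diff \<alpha> (weyl_sum \<alpha> (t N)) n - g n)
      = l1_norm \<phi> (\<lambda>n. if n < N then 0 else g n)" for N
    unfolding l1_weighted_weyl_diff[OF l1_weighted_finite[OF fin]] l1_norm_def
    by (intro suminf_cong) (simp add: t_def)
  ultimately show "completion_rel \<alpha> \<phi> f g"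
    unfolding completion_rel_def using g l1_norm_tail[OF g] l1_weighted_weyl_sums[OF g] f
    by (auto intro!: exI[of _ "\<lambda>N. weyl_sum \<alpha> (t N)"])
qed

lemma weyl_sum_in_tau: "g \<in> l1_weighted \<phi> \<Longrightarrow> weyl_sum \<alpha> g \<in> tau \<alpha> \<phi>"
  by (auto simp: tau_def completion_rel_iff)

lemma weyl_ext_weyl_sum: "g \<in> l1_weighted \<phi> \<Longrightarrow> weyl_ext \<alpha> \<phi> (weyl_sum \<alpha> g) = g"
  unfolding weyl_ext_def completion_rel_iff by (rule the_equality) (auto, metis l1_weighted_weyl_diff)

lemma tau_obtain:
  assumes "f \<in> tau \<alpha> \<phi>"
  obtains g where "g \<in> l1_weighted \<phi>" "f = weyl_sum \<alpha> g" "weyl_ext \<alpha> \<phi> f = g"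
  using assms weyl_ext_weyl_sum by (auto simp: tau_def completion_rel_iff)

lemma h_seq_in_tau: "h_seq \<alpha> n \<in> tau \<alpha> \<phi>"
proof -
  have "finite {m. delta_seq n m \<noteq> 0}"
    by (simp add: delta_seq_def)
  then show ?thesis
    using weyl_sum_in_tau[OF l1_weighted_finite] weyl_sum_delta_seq by metis
qed

lemma tau_lincomb:
  assumes "f \<in> tau \<alpha> \<phi>" "g \<in> tau \<alpha> \<phi>"
  shows "(\<lambda>n. f n + c * g n) \<in> tau \<alpha> \<phi>"
proof -
  obtain f' where "f' \<in> l1_weighted \<phi>" "f = weyl_sum \<alpha> f'"
    using assms(1) by (rule tau_obtain)
  moreover obtain g' where "g' \<in> l1_weighted \<phi>" "g = weyl_sum \<alpha> g'"
    using assms(2) by (rule tau_obtain)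
  ultimately show ?thesis
    using weyl_sum_in_tau[OF l1_weighted_lincomb, of f' g' c] weyl_sum_lincomb by simp
qed

lemma tau_scale: "f \<in> tau \<alpha> \<phi> \<Longrightarrow> (\<lambda>n. c * f n) \<in> tau \<alpha> \<phi>"
  using tau_lincomb[of f f "c - 1"] by (simp add: algebra_simps)

lemma tau_zero: "(\<lambda>n. 0) \<in> tau \<alpha> \<phi>"
  using tau_scale[OF h_seq_in_tau, of 0] by simp

lemma tau_sum:
  assumes "finite A" "\<And>i. i \<in> A \<Longrightarrow> f i \<in> tau \<alpha> \<phi>"
  shows "(\<lambda>n. \<Sum>i\<in>A. c i * f i n) \<in> tau \<alpha> \<phi>"
  using assms
proof (induction rule: finite_induct)
  case (insert i A)
  then show ?case
    using tau_lincomb[of "\<lambda>n. \<Sum>i\<in>A. c i * f i n" "f i" "c i"] by (simp add: add.commute)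
qed (simp add: tau_zero)

lemma h_seq_delta_seq:
  "h_seq \<alpha> n = (\<lambda>m. \<Sum>j\<in>{0..n}. of_real (cesaro_k \<alpha> (n - j)) * delta_seq j m)"
proof
  fix m
  have "(\<Sum>j\<in>{0..n}. of_real (cesaro_k \<alpha> (n - j)) * delta_seq j m)
      = (\<Sum>j\<in>{0..n}. if m = j then of_real (cesaro_k \<alpha> (n - j)) else 0)"
    by (intro sum.cong) (auto simp: delta_seq_def)
  then show "h_seq \<alpha> n m = (\<Sum>j\<in>{0..n}. of_real (cesaro_k \<alpha> (n - j)) * delta_seq j m)"
    by (simp add: h_seq_def)
qed

lemma delta_seq_in_tau: "delta_seq j \<in> tau \<alpha> \<phi>"
proof (induction j rule: less_induct)
  case (less j)
  let ?s = "\<lambda>m. \<Sum>i\<in>{0..<j}. of_real (cesaro_k \<alpha> (j - i)) * delta_seq i m"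
  have "delta_seq j = (\<lambda>m. h_seq \<alpha> j m + (- 1) * ?s m)"
    unfolding h_seq_delta_seq
    by (auto simp: atLeast0AtMost atLeast0LessThan cesaro_k_0 alpha_pos
        simp flip: lessThan_Suc_atMost)
  then show ?case
    using tau_lincomb[OF h_seq_in_tau, of ?s j "- 1"] tau_sum[of "{0..<j}" delta_seq] less by auto
qed

text \<open>The geometric sequence \<open>p_seq c\<close> is an eigenvector of \<open>weyl_sum \<alpha>\<close> with eigenvalue
  \<open>(1 - 1/c) powr (- \<alpha>)\<close>.\<close>

lemma p_seq_in_tau:
  assumes "a > 0" "\<And>n. \<phi> n \<le> C * a ^ n" "cmod c > a"
  shows "p_seq c \<in> tau \<alpha> \<phi>"
proof -
  obtain d where d: "d > 0" "\<And>n. d * cesaro_k (\<alpha> + 1) n \<le> \<phi> n"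
    using phi_ge_cesaro_k by blast
  have lower: "d \<le> C * a ^ n" for n
  proof -
    have "d * 1 \<le> d * cesaro_k (\<alpha> + 1) n"
      using d(1) alpha_pos by (intro mult_left_mono cesaro_k_ge_1) auto
    then show ?thesis
      using d(2)[of n] assms(2)[of n] by simp
  qed
  have "a \<ge> 1"
  proof (rule ccontr)
    assume "\<not> a \<ge> 1"
    then have "(\<lambda>n. C * a ^ n) \<longlonglongrightarrow> C * 0"
      using assms(1) by (intro tendsto_mult tendsto_const LIMSEQ_realpow_zero) auto
    then have "d \<le> C * 0"
      by (rule Lim_bounded2) (use lower in auto)
    then show False
      using d(1) by simp
  qed
  then have c: "c \<noteq> 0" "cmod c > 1"
    using assms(3) by auto
  define z where "z = inverse c"
  have z: "cmod z < 1" "z \<noteq> 1"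
    using c by (auto simp: z_def norm_inverse inverse_less_1_iff)
  define S where "S = (1 + - z) powr (of_real (- \<alpha>))"
  have "S \<noteq> 0"
    using z(2) by (simp add: S_def)
  have "(\<lambda>i. (of_real (- \<alpha>) gchoose i) * (- z) ^ i) sums S"
    unfolding S_def using z(1) by (intro gen_binomial_complex) simp
  moreover have "(of_real (- \<alpha>) gchoose i) * (- z) ^ i = of_real (cesaro_k \<alpha> i) * z ^ i" for i
  proof -
    have "(of_real (- \<alpha>) gchoose i :: complex) = (- 1) ^ i * of_real (cesaro_k \<alpha> i)"
      using alpha_pos
      by (simp add: gbinomial_pochhammer cesaro_k_pochhammer pochhammer_of_real)
    then show ?thesis
      by (simp add: power_minus[of z])
  qed
  ultimately have S: "(\<lambda>i. of_real (cesaro_k \<alpha> i) * z ^ i) sums S"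
    by simp
  define g where "g = (\<lambda>n. inverse S * p_seq c n)"
  have p: "p_seq c (n + i) = p_seq c n * z ^ i" for n i
    by (simp add: p_seq_def z_def power_add power_inverse)
  have "summable (\<lambda>n. C * cmod (inverse S) * inverse (cmod c) * (a / cmod c) ^ n)"
    using assms(1,3) c by (intro summable_mult summable_geometric) simp
  then have "summable (\<lambda>n. \<phi> n * cmod (g n))"
  proof (rule summable_comparison_test[rotated], intro exI allI impI)
    fix n
    have "\<phi> n * cmod (g n) \<le> C * a ^ n * cmod (g n)"
      using assms(2)[of n] by (rule mult_right_mono) simp
    also have "\<dots> = C * cmod (inverse S) * inverse (cmod c) * (a / cmod c) ^ n"
      by (simp add: g_def p_seq_def norm_mult norm_inverse norm_power norm_divide power_divide divide_simps)
    finally show "norm (\<phi> n * cmod (g n)) \<le> \<dots>"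
      using phi_pos[of n] by (simp add: abs_mult)
  qed
  then have "g \<in> l1_weighted \<phi>"
    by (simp add: l1_weighted_def)
  moreover have "weyl_sum \<alpha> g = p_seq c"
  proof
    fix n
    have "(\<lambda>i. of_real (cesaro_k \<alpha> i) * g (n + i)) sums (g n * S)"
      using sums_mult[OF S, of "g n"] by (simp add: g_def p mult_ac)
    then show "weyl_sum \<alpha> g n = p_seq c n"
      using \<open>S \<noteq> 0\<close> by (simp add: weyl_sum_def sums_iff g_def)
  qed
  ultimately show ?thesis
    using weyl_sum_in_tau by metis
qed

end

section \<open>Complex-linear operators\<close>

lemma bounded_linear_scaleC: "bounded_linear (\<lambda>x::'a::complex_banach. c *\<^sub>C x)"
proof (rule bounded_linear_intro)
  show "c *\<^sub>C (r *\<^sub>R x) = r *\<^sub>R (c *\<^sub>C x)" for r and x :: 'a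
    by (simp add: scaleC_scaleC mult.commute flip: scaleC_of_real)
  show "norm (c *\<^sub>C x) \<le> norm x * cmod c" for x :: 'a
    by (simp add: norm_scaleC mult.commute)
qed (rule scaleC_add_right)

lemma scaleC_diff_right: "c *\<^sub>C (x - y) = c *\<^sub>C x - c *\<^sub>C (y::'a::complex_banach)"
  by (simp add: bounded_linear_scaleC linear_simps)

lemma scaleC_one: "1 *\<^sub>C x = (x::'a::complex_banach)"
  using scaleC_of_real[of 1 x] by simp

lemma op_power_0: "op_power T 0 = id_blinfun"
  by (simp add: op_power_def)

lemma op_power_Suc: "op_power T (Suc n) = T o\<^sub>L op_power T n"
  by (simp add: op_power_def)

lemma op_power_Suc_right: "op_power T (Suc n) = op_power T n o\<^sub>L T"
proof (induction n)
  case 0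
  show ?case
    by (auto simp: op_power_Suc op_power_0 intro!: blinfun_eqI)
next
  case (Suc n)
  have "op_power T (Suc (Suc n)) = T o\<^sub>L (op_power T n o\<^sub>L T)"
    by (simp only: op_power_Suc[of T "Suc n"] Suc)
  also have "\<dots> = op_power T (Suc n) o\<^sub>L T"
    by (auto simp: op_power_Suc intro!: blinfun_eqI)
  finally show ?case .
qed

lemma norm_op_power: "norm (op_power T n) \<le> norm T ^ n"
proof (induction n)
  case 0
  then show ?case
    by (simp add: op_power_def norm_blinfun_id_le)
next
  case (Suc n)
  have "norm (op_power T (Suc n)) \<le> norm T * norm (op_power T n)"
    unfolding op_power_Suc by (rule norm_blinfun_compose)
  also have "\<dots> \<le> norm T * norm T ^ n"
    using Suc by (intro mult_left_mono) auto
  finally show ?case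
    by simp
qed

lemma neumann_series:
  fixes U :: "'a::banach \<Rightarrow>\<^sub>L 'a"
  assumes "norm U < 1"
  obtains S where "S o\<^sub>L (id_blinfun - U) = id_blinfun" "(id_blinfun - U) o\<^sub>L S = id_blinfun"
proof
  define S where "S = (\<Sum>n. op_power U n)"
  have summ: "summable (op_power U)"
    using assms norm_op_power
    by (intro summable_comparison_test[OF _ summable_geometric[of "norm U"]]) auto
  have shift: "(\<Sum>n. op_power U (Suc n)) = S - id_blinfun"
    using suminf_split_head[OF summ] by (simp add: S_def op_power_0)
  have "S o\<^sub>L U = S - id_blinfun"
    unfolding S_def
    using bounded_linear.suminf[OF bounded_bilinear.bounded_linear_left[OF
          bounded_bilinear_blinfun_compose] summ, of U] shift
    by (simp add: op_power_Suc_right S_def)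
  then show "S o\<^sub>L (id_blinfun - U) = id_blinfun"
    by (auto simp: bounded_bilinear.diff_right[OF bounded_bilinear_blinfun_compose] intro!: blinfun_eqI)
  have "U o\<^sub>L S = S - id_blinfun"
    unfolding S_def
    using bounded_linear.suminf[OF bounded_bilinear.bounded_linear_right[OF
          bounded_bilinear_blinfun_compose] summ, of U] shift
    by (simp add: op_power_Suc S_def)
  then show "(id_blinfun - U) o\<^sub>L S = id_blinfun"
    by (auto simp: bounded_bilinear.diff_left[OF bounded_bilinear_blinfun_compose] intro!: blinfun_eqI)
qed

lemma resolvent_exists:
  fixes T :: "'a::complex_banach \<Rightarrow>\<^sub>L 'a"
  assumes T: "T \<in> bounded_ops" and c: "cmod c > norm T"
  obtains R where "is_resolvent c T R"
proof -
  have c0: "c \<noteq> 0"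
    using c norm_ge_zero[of T] by (metis leD norm_zero)
  have T_scale: "T (d *\<^sub>C x) = d *\<^sub>C T x" for d x
    using T by (simp add: bounded_ops_def)
  define D :: "'a \<Rightarrow>\<^sub>L 'a" where "D = Blinfun (\<lambda>x. inverse c *\<^sub>C x)"
  have D: "D x = inverse c *\<^sub>C x" for x
    by (simp add: D_def bounded_linear_Blinfun_apply bounded_linear_scaleC)
  define U where "U = D o\<^sub>L T"
  have "norm U \<le> norm T / cmod c"
  proof (rule norm_blinfun_bound)
    fix x
    show "norm (U x) \<le> norm T / cmod c * norm x"
      using norm_blinfun[of T x] c0
      by (simp add: U_def D norm_scaleC norm_divide divide_simps)
  qed simp
  then have "norm U < 1"
    using c c0 by (smt (verit) divide_less_eq_1_pos norm_ge_zero)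
  then obtain S where S: "S o\<^sub>L (id_blinfun - U) = id_blinfun" "(id_blinfun - U) o\<^sub>L S = id_blinfun"
    by (rule neumann_series)
  define R where "R = S o\<^sub>L D"
  have V: "D (c *\<^sub>C x - T x) = (id_blinfun - U) x" for x
    using c0 by (simp add: U_def D blinfun.diff_left scaleC_diff_right scaleC_scaleC scaleC_one)
  have left: "R (c *\<^sub>C x - T x) = x" for x
    using V[of x] arg_cong[OF S(1), of "\<lambda>A. blinfun_apply A x"] by (simp add: R_def)
  have right: "c *\<^sub>C R x - T (R x) = x" for x
  proof -
    have "inverse c *\<^sub>C (c *\<^sub>C R x - T (R x)) = inverse c *\<^sub>C x"
      using V[of "R x"] arg_cong[OF S(2), of "\<lambda>A. blinfun_apply A (D x)"] by (simp add: R_def D)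
    from arg_cong[OF this, of "\<lambda>y. c *\<^sub>C y"] show ?thesis
      using c0 by (simp add: scaleC_scaleC scaleC_one)
  qed
  have "R (d *\<^sub>C x) = d *\<^sub>C R x" for d x
  proof -
    have "d *\<^sub>C x = c *\<^sub>C (d *\<^sub>C R x) - T (d *\<^sub>C R x)"
      using arg_cong[OF right[of x], of "\<lambda>y. d *\<^sub>C y"]
      by (simp add: T_scale scaleC_diff_right scaleC_scaleC mult.commute)
    then show ?thesis
      using left[of "d *\<^sub>C R x"] by simp
  qed
  then show thesis
    by (intro that[of R]) (simp add: is_resolvent_def bounded_ops_def left right)
qed

section \<open>Homomorphisms\<close>

locale tau_hom = omega_weight +
  fixes \<theta> :: "(nat \<Rightarrow> complex) \<Rightarrow> ('a::complex_banach \<Rightarrow>\<^sub>L 'a)"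
  assumes hom: "algebra_hom \<alpha> \<phi> \<theta>"
begin

definition gen :: "'a \<Rightarrow>\<^sub>L 'a" where "gen = \<theta> (delta_seq 1)"

lemma hom_bounded_ops: "f \<in> tau \<alpha> \<phi> \<Longrightarrow> \<theta> f \<in> bounded_ops"
  using hom by (simp add: algebra_hom_def)

lemma hom_lincomb:
  assumes "f \<in> tau \<alpha> \<phi>" "g \<in> tau \<alpha> \<phi>"
  shows "\<theta> (\<lambda>n. f n + c * g n) x = \<theta> f x + c *\<^sub>C \<theta> g x"
proof -
  have "\<theta> (\<lambda>n. f n + c * g n) = \<theta> f + \<theta> (\<lambda>n. c * g n)"
    using hom[unfolded algebra_hom_def, THEN conjunct2, THEN conjunct1, THEN bspec, OF assms(1),
        THEN bspec, OF tau_scale[OF assms(2)]] .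
  moreover have "\<theta> (\<lambda>n. c * g n) x = c *\<^sub>C \<theta> g x"
    using hom assms unfolding algebra_hom_def by blast
  ultimately show ?thesis
    by (simp add: blinfun.add_left)
qed

lemma hom_convolution:
  "f \<in> tau \<alpha> \<phi> \<Longrightarrow> g \<in> tau \<alpha> \<phi> \<Longrightarrow> \<theta> (convolution f g) = \<theta> f o\<^sub>L \<theta> g"
  using hom by (simp add: algebra_hom_def)

lemma hom_zero: "\<theta> (\<lambda>n. 0) x = 0"
  using hom_lincomb[OF tau_zero tau_zero, of 1 x] by (simp add: scaleC_one)

lemma hom_sum:
  assumes "finite A" "\<And>i. i \<in> A \<Longrightarrow> f i \<in> tau \<alpha> \<phi>"
  shows "\<theta> (\<lambda>n. \<Sum>i\<in>A. c i * f i n) x = (\<Sum>i\<in>A. c i *\<^sub>C \<theta> (f i) x)"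
  using assms
proof (induction rule: finite_induct)
  case (insert i A)
  then show ?case
    using hom_lincomb[of "\<lambda>n. \<Sum>i\<in>A. c i * f i n" "f i" "c i" x] tau_sum[of A f c]
    by (simp add: add.commute)
qed (simp add: hom_zero)

lemma hom_delta_seq_0: "\<theta> (delta_seq 0) = id_blinfun"
proof -
  have "delta_seq 0 = unit_seq"
    by (auto simp: delta_seq_def unit_seq_def)
  then show ?thesis
    using hom by (simp add: algebra_hom_def)
qed

lemma hom_delta_seq: "\<theta> (delta_seq j) = op_power gen j"
proof (induction j)
  case 0
  then show ?case
    by (simp add: hom_delta_seq_0 op_power_def)
next
  case (Suc j)
  have "\<theta> (delta_seq (Suc j)) = \<theta> (delta_seq 1) o\<^sub>L \<theta> (delta_seq j)"
    using hom_convolution[OF delta_seq_in_tau delta_seq_in_tau, of 1 j]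
    unfolding convolution_delta_seq_1 .
  then show ?case
    using Suc by (simp add: op_power_Suc gen_def)
qed

lemma hom_h_seq: "\<theta> (h_seq \<alpha> n) = cesaro_sum \<alpha> gen n"
proof (rule blinfun_eqI)
  fix x
  have "\<theta> (h_seq \<alpha> n) x = (\<Sum>j=0..n. of_real (cesaro_k \<alpha> (n - j)) *\<^sub>C \<theta> (delta_seq j) x)"
    unfolding h_seq_delta_seq by (rule hom_sum) (auto intro: delta_seq_in_tau)
  then show "\<theta> (h_seq \<alpha> n) x = cesaro_sum \<alpha> gen n x"
    by (simp add: hom_delta_seq scaleC_of_real cesaro_sum_def blinfun.sum_left blinfun.scaleR_left)
qed

lemma hom_p_seq:
  assumes R: "is_resolvent c gen R" and p: "p_seq c \<in> tau \<alpha> \<phi>" and "c \<noteq> 0"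
  shows "\<theta> (p_seq c) = R"
proof (rule blinfun_eqI)
  fix x
  let ?f = "\<lambda>n. (\<lambda>n. c * delta_seq 0 n) n + (- 1) * delta_seq 1 n"
  have f: "?f \<in> tau \<alpha> \<phi>"
    by (intro tau_lincomb tau_scale delta_seq_in_tau)
  have "convolution ?f (p_seq c) = delta_seq 0"
  proof
    fix n
    show "convolution ?f (p_seq c) n = delta_seq 0 n"
    proof (cases n)
      case 0
      then show ?thesis
        using \<open>c \<noteq> 0\<close> by (simp add: convolution_def delta_seq_def p_seq_def)
    next
      case (Suc m)
      have "(\<Sum>j\<in>{0..<m}. ?f (Suc m - j) * p_seq c j) = 0"
        by (intro sum.neutral) (auto simp: delta_seq_def)
      moreover have "convolution ?f (p_seq c) n = (\<Sum>j\<in>{0..<m}. ?f (Suc m - j) * p_seq c j)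
          + ?f 1 * p_seq c m + ?f 0 * p_seq c (Suc m)"
        unfolding convolution_def Suc
        by (simp add: atLeast0AtMost atLeast0LessThan flip: lessThan_Suc_atMost)
      ultimately show ?thesis
        using \<open>c \<noteq> 0\<close> Suc by (simp add: delta_seq_def p_seq_def field_simps)
    qed
  qed
  then have "id_blinfun = \<theta> ?f o\<^sub>L \<theta> (p_seq c)"
    using hom_convolution[OF f p] by (simp add: hom_delta_seq_0)
  then have "x = \<theta> ?f (\<theta> (p_seq c) x)"
    by (metis blinfun_apply_blinfun_compose id_blinfun.rep_eq)
  also have "\<dots> = c *\<^sub>C \<theta> (p_seq c) x - gen (\<theta> (p_seq c) x)"
  proof -
    have "\<theta> ?f y = c *\<^sub>C y - gen y" for y
    proof -
      have "\<theta> ?f y = \<theta> (\<lambda>n. c * delta_seq 0 n) y + (- 1) *\<^sub>C gen y"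
        unfolding gen_def by (intro hom_lincomb tau_scale delta_seq_in_tau)
      moreover have "\<theta> (\<lambda>n. c * delta_seq 0 n) y = c *\<^sub>C y"
        using hom delta_seq_in_tau[of 0] hom_delta_seq_0 by (simp add: algebra_hom_def)
      moreover have "(- 1) *\<^sub>C gen y = - gen y"
        using scaleC_of_real[of "- 1" "gen y"] by simp
      ultimately show ?thesis
        by simp
    qed
    then show ?thesis .
  qed
  finally have "c *\<^sub>C \<theta> (p_seq c) x - gen (\<theta> (p_seq c) x) = x" ..
  then show "\<theta> (p_seq c) x = R x"
    using R unfolding is_resolvent_def by metis
qed

lemma hom_sums:
  assumes bounded: "\<And>f. f \<in> tau \<alpha> \<phi> \<Longrightarrow> norm (\<theta> f) \<le> K * tau_norm \<alpha> \<phi> f"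
    and f: "f \<in> tau \<alpha> \<phi>"
  shows "(\<lambda>n. weyl_ext \<alpha> \<phi> f n *\<^sub>C cesaro_sum \<alpha> gen n x) sums \<theta> f x"
proof -
  obtain g where g: "g \<in> l1_weighted \<phi>" "f = weyl_sum \<alpha> g" and ext: "weyl_ext \<alpha> \<phi> f = g"
    using f by (rule tau_obtain)
  define P where "P N = (\<lambda>m. \<Sum>n<N. g n * h_seq \<alpha> n m)" for N
  define tail where "tail N n = (if n < N then 0 else g n)" for N n
  have P_tau: "P N \<in> tau \<alpha> \<phi>" for N
    unfolding P_def by (rule tau_sum) (auto intro: h_seq_in_tau)
  have "\<theta> (P N) x = (\<Sum>n<N. g n *\<^sub>C \<theta> (h_seq \<alpha> n) x)" for N
    unfolding P_def by (rule hom_sum) (auto intro: h_seq_in_tau)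
  then have \<theta>P: "\<theta> (P N) x = (\<Sum>n<N. g n *\<^sub>C cesaro_sum \<alpha> gen n x)" for N
    by (simp add: hom_h_seq)
  have tail_l1: "tail N \<in> l1_weighted \<phi> \<and> weyl_sum \<alpha> (tail N) = (\<lambda>n. f n + (- 1) * P N n)" for N
  proof (induction N)
    case 0
    then show ?case
      using g by (simp add: tail_def P_def)
  next
    case (Suc N)
    have delta: "delta_seq N \<in> l1_weighted \<phi>"
      by (rule l1_weighted_finite) (simp add: delta_seq_def)
    have eq: "tail (Suc N) = (\<lambda>n. tail N n + (- g N) * delta_seq N n)"
      by (auto simp: tail_def delta_seq_def fun_eq_iff less_Suc_eq)
    show ?case
      unfolding eq
      using l1_weighted_lincomb[OF _ delta, of "tail N" "- g N"]
        weyl_sum_lincomb[OF _ delta, of "tail N" "- g N"] Suc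
      by (auto simp: weyl_sum_delta_seq P_def)
  qed
  have "norm (\<theta> (P N) x - \<theta> f x) \<le> K * l1_norm \<phi> (tail N) * norm x" for N
  proof -
    have tau: "weyl_sum \<alpha> (tail N) \<in> tau \<alpha> \<phi>"
      using tail_l1 weyl_sum_in_tau by blast
    have "\<theta> (weyl_sum \<alpha> (tail N)) x = \<theta> f x + (- 1) *\<^sub>C \<theta> (P N) x"
      using hom_lincomb[OF f P_tau, of "- 1"] tail_l1 by simp
    then have "\<theta> (weyl_sum \<alpha> (tail N)) x = \<theta> f x - \<theta> (P N) x"
      using scaleC_of_real[of "- 1" "\<theta> (P N) x"] by simp
    then have "norm (\<theta> (P N) x - \<theta> f x) \<le> norm (\<theta> (weyl_sum \<alpha> (tail N))) * norm x"
      by (metis norm_blinfun norm_minus_commute)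
    also have "\<dots> \<le> K * l1_norm \<phi> (tail N) * norm x"
      using bounded[OF tau] weyl_ext_weyl_sum[OF conjunct1[OF tail_l1], of N]
      by (intro mult_right_mono) (simp_all only: tau_norm_def norm_ge_zero)
    finally show ?thesis .
  qed
  then have le: "\<forall>\<^sub>F N in sequentially. norm (\<theta> (P N) x - \<theta> f x) \<le> K * l1_norm \<phi> (tail N) * norm x"
    by simp
  have "(\<lambda>N. K * l1_norm \<phi> (tail N) * norm x) \<longlonglongrightarrow> K * 0 * norm x"
    unfolding tail_def by (intro tendsto_mult tendsto_const l1_norm_tail g)
  then have "(\<lambda>N. K * l1_norm \<phi> (tail N) * norm x) \<longlonglongrightarrow> 0"
    by simp
  with le have "(\<lambda>N. \<theta> (P N) x - \<theta> f x) \<longlonglongrightarrow> 0"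
    by (rule Lim_null_comparison)
  then have "(\<lambda>N. \<theta> (P N) x) \<longlonglongrightarrow> \<theta> f x"
    by (simp add: LIM_zero_iff)
  then show ?thesis
    unfolding sums_def ext by (simp add: \<theta>P)
qed

end

theorem corollary6:
  fixes \<alpha> :: real and \<phi> :: "nat \<Rightarrow> real"
    and \<theta> :: "(nat \<Rightarrow> complex) \<Rightarrow> ('a::complex_banach \<Rightarrow>\<^sub>L 'a)"
  assumes "\<alpha> > 0"
    and "\<phi> \<in> omega \<alpha>"
    and "algebra_hom \<alpha> \<phi> \<theta>"
    and bounded: "\<exists>K. \<forall>f\<in>tau \<alpha> \<phi>. norm (\<theta> f) \<le> K * tau_norm \<alpha> \<phi> f"
  shows "\<exists>T\<in>bounded_ops.
    (\<forall>f\<in>tau \<alpha> \<phi>. \<forall>x.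
       (\<lambda>n. weyl_ext \<alpha> \<phi> f n *\<^sub>C blinfun_apply (cesaro_sum \<alpha> T n) x)
         sums blinfun_apply (\<theta> f) x) \<and>
    (\<forall>n. h_seq \<alpha> n \<in> tau \<alpha> \<phi> \<and> \<theta> (h_seq \<alpha> n) = cesaro_sum \<alpha> T n) \<and>
    (\<forall>c. cmod c > norm T \<longrightarrow>
       (\<exists>R. is_resolvent c T R \<and> (p_seq c \<in> tau \<alpha> \<phi> \<longrightarrow> \<theta> (p_seq c) = R))) \<and>
    (\<forall>C a c. a > 0 \<and> (\<forall>n. \<phi> n \<le> C * a ^ n) \<and> cmod c > a \<longrightarrow> p_seq c \<in> tau \<alpha> \<phi>)"
proof -
  interpret tau_hom \<alpha> \<phi> \<theta>
    using assms by unfold_locales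
  obtain K where K: "\<And>f. f \<in> tau \<alpha> \<phi> \<Longrightarrow> norm (\<theta> f) \<le> K * tau_norm \<alpha> \<phi> f"
    using bounded by blast
  have gen: "gen \<in> bounded_ops"
    unfolding gen_def by (intro hom_bounded_ops delta_seq_in_tau)
  show ?thesis
  proof (intro bexI[OF _ gen] conjI ballI allI impI)
    fix c assume c: "cmod c > norm gen"
    then have "c \<noteq> 0"
      using norm_ge_zero[of gen] by (metis leD norm_zero)
    obtain R where "is_resolvent c gen R"
      using resolvent_exists[OF gen c] .
    then show "\<exists>R. is_resolvent c gen R \<and> (p_seq c \<in> tau \<alpha> \<phi> \<longrightarrow> \<theta> (p_seq c) = R)"
      using hom_p_seq \<open>c \<noteq> 0\<close> by blast
  next
    fix C a c assume "a > 0 \<and> (\<forall>n. \<phi> n \<le> C * a ^ n) \<and> cmod c > a"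
    then show "p_seq c \<in> tau \<alpha> \<phi>"
      using p_seq_in_tau by blast
  qed (use hom_sums[OF K] h_seq_in_tau hom_h_seq in auto)
qed

end
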